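(* Let $\alpha,\beta>0$, $\rho:=\log_2(\alpha+\beta)$, $f,g,\varphi$ as in the context, and assume $g(n)=n^\rho+g_0(n)$ for $n\ge2$, where $g_0(n)=O(n^{\rho-\varepsilon})$ for some $\varepsilon>0$. Then $$f(n)=n^\rho\log_2n+n^\rho P(\log_2n)-Q(n),\qquad n\ge1,$$ where $P$ is a continuous $1$-periodic function and $Q(n)=o(n^\rho)$ as $n\to\infty$. The Mellin transform $g^*(s):=\int_1^\infty g(x)x^{s-1}\,dx$ (defined for $\operatorname{Re}s<-\rho$) extends meromorphically to $\operatorname{Re}s<-\rho+\min(\varepsilon,1)$ with a sole simple pole at $s=-\rho$, and with $\chi_k:=\frac{2k\pi}{\log2}i$ the Fourier coefficients $\widehat P(k):=\int_0^1P(t)e^{-2k\pi it}dt$ are $$\widehat P(k)=\frac{f(1)}{\log2}\int_0^1\frac{1+(\alpha+\beta-1)\varphi(u)}{(1+u)^{\rho+\chi_k+1}}\,du+\begin{cases}\frac1{\log2}g^*(-\rho-\chi_k),&k\ne0,\\ \frac1{\log2}g^*(-\rho)\big|_{\mathrm{FV}}+\frac12,&k=0,\end{cases}$$ where $F(s)|_{\mathrm{FV}}$ denotes the constant term of the Laurent expansion of $F$ at $s$. If moreover $g(n)=n^\rho$ for all even $n\ge2$, then $Q(n)=0$ for all $n\ge1$.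
   Context: Let $(f(n))_{n\ge1}$, $(g(n))_{n\ge2}$ be real sequences with $f(n)=\alpha f(\lfloor n/2\rfloor)+\beta f(\lceil n/2\rceil)+g(n)$ for $n\ge2$; set $g(1):=0$. Let $\varphi$ be the unique continuous function on $[0,1]$ with $\varphi(0)=0$, $\varphi(1)=1$, $\varphi(t)=\frac{\beta}{\alpha+\beta}\varphi(2t)$ on $[0,\frac12]$, $\varphi(t)=\frac{\alpha}{\alpha+\beta}\varphi(2t-1)+\frac{\beta}{\alpha+\beta}$ on $[\frac12,1]$. Extend $g$ to real $x\ge1$ by $g(n+t):=(1-\varphi(t))g(n)+\varphi(t)g(n+1)$ ($n\ge1$, $t\in[0,1]$), and $g(x):=0$ for $0\le x<1$. *)

theory Defs
  imports "HOL-Complex_Analysis.Complex_Analysis" "HOL-Library.Landau_Symbols"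
begin

text \<open>
  On \<open>[0,1]\<close> these conditions determine \<open>\<phi>\<close> uniquely when \<open>\<alpha>, \<beta> > 0\<close>;
  the values of \<open>\<phi>\<close> outside \<open>[0,1]\<close> are never used.
\<close>
definition interpolation_fun :: "real \<Rightarrow> real \<Rightarrow> (real \<Rightarrow> real) \<Rightarrow> bool" where
  "interpolation_fun \<alpha> \<beta> \<phi> \<longleftrightarrow>
     continuous_on {0..1} \<phi> \<and> \<phi> 0 = 0 \<and> \<phi> 1 = 1 \<and>
     (\<forall>t\<in>{0..1/2}. \<phi> t = \<beta> / (\<alpha> + \<beta>) * \<phi> (2 * t)) \<and>
     (\<forall>t\<in>{1/2..1}. \<phi> t = \<alpha> / (\<alpha> + \<beta>) * \<phi> (2 * t - 1) + \<beta> / (\<alpha> + \<beta>))"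

text \<open>
  Here \<open>n = \<lfloor>x\<rfloor>\<close> and \<open>t = frac x \<in> [0,1)\<close>; the case \<open>t = 1\<close> of the interpolation formula is
  consistent with this because \<open>\<phi> 0 = 0\<close> and \<open>\<phi> 1 = 1\<close>.
\<close>
definition interpolate :: "(real \<Rightarrow> real) \<Rightarrow> (nat \<Rightarrow> real) \<Rightarrow> real \<Rightarrow> real" where
  "interpolate \<phi> g x =
     (if x < 1 then 0
      else (1 - \<phi> (frac x)) * g (nat \<lfloor>x\<rfloor>) + \<phi> (frac x) * g (nat \<lfloor>x\<rfloor> + 1))"

definition mellin_integrand :: "(real \<Rightarrow> real) \<Rightarrow> complex \<Rightarrow> real \<Rightarrow> complex" where
  "mellin_integrand h s x = complex_of_real (h x) * complex_of_real x powr (s - 1)"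

definition mellin :: "(real \<Rightarrow> real) \<Rightarrow> complex \<Rightarrow> complex" where
  "mellin h s = integral {1..} (mellin_integrand h s)"

definition chi :: "int \<Rightarrow> complex" where
  "chi k = complex_of_real (2 * of_int k * pi / ln 2) * \<i>"

definition fourier_coeff :: "(real \<Rightarrow> real) \<Rightarrow> int \<Rightarrow> complex" where
  "fourier_coeff P k =
     integral {0..1} (\<lambda>t. complex_of_real (P t) * exp (- 2 * of_int k * of_real pi * \<i> * of_real t))"

definition finite_value :: "(complex \<Rightarrow> complex) \<Rightarrow> complex \<Rightarrow> complex" where
  "finite_value F s = fls_nth (laurent_expansion F s) 0"

end

theory Submission
  imports Defs
begin

text \<open>
  The functional equation of \<open>\<phi>\<close> is made so that the interpolated sequences satisfy
  \<open>f(x) = 2\<^sup>\<rho> f(x/2) + g(x)\<close> for all real \<open>x \<ge> 2\<close>. Put \<open>D(x) = x\<^bsup>-\<rho>\<^esup> g(x) - 1\<close>, which is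
  \<open>O(x\<^bsup>-\<delta>\<^esup>)\<close> with \<open>\<delta> = min \<epsilon> 1\<close>. Iterating down to \<open>y = x / 2\<^sup>m \<in> [1,2)\<close> gives
  \<open>x\<^bsup>-\<rho>\<^esup> f(x) = m + 1 + \<Sum>\<^bsub>j\<le>m\<^esub> D(2\<^sup>j y) + f(1) (1 + (\<alpha>+\<beta>-1) \<phi>(y-1)) y\<^bsup>-\<rho>\<^esup>\<close>. Completing the sum to
  an infinite one yields \<open>P\<close>, and the tail \<open>\<Sum>\<^bsub>j\<ge>1\<^esub> D(2\<^sup>j x)\<close> yields \<open>x\<^bsup>-\<rho>\<^esup> Q(x)\<close>. The
  substitution \<open>x = 2\<^bsup>j+t\<^esup>\<close> turns the Fourier integrals of \<open>\<Sum>\<^bsub>j\<ge>0\<^esub> D(2\<^bsup>j+t\<^esup>)\<close> into values of the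
  Mellin transform of \<open>D\<close>, which is holomorphic for \<open>Re s < \<delta>\<close>, and
  \<open>g\<^sup>*(s) = D\<^sup>*(s+\<rho>) - 1/(s+\<rho>)\<close>. For \<open>k \<noteq> 0\<close> the term \<open>1/\<chi>\<^sub>k\<close> is exactly the Fourier coefficient of
  the sawtooth \<open>m + 1 - log\<^sub>2 x\<close>.
\<close>

section \<open>Gluing continuous functions along unit intervals\<close>

text \<open>Continuity on each closed unit interval is one-sided at the integers. Every
  \<open>x\<close> is interior to the union of the two closed intervals that meet at
  \<open>\<lfloor>x\<rfloor>\<close>, and continuity glues over a finite closed union.\<close>

lemma continuous_on_unit_intervals:
  fixes F :: "real \<Rightarrow> 'a :: topological_space"
  assumes "\<And>n :: int. continuous_on {of_int n..of_int n + 1} F"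
  shows "continuous_on UNIV F"
proof -
  have "continuous (at x) F" for x
  proof -
    define n where "n = \<lfloor>x\<rfloor>"
    have "continuous_on ({of_int (n - 1)..of_int (n - 1) + 1} \<union> {of_int n..of_int n + 1}) F"
      by (intro continuous_on_closed_Un assms closed_atLeastAtMost)
    also have "{of_int (n - 1)..of_int (n - 1) + 1} \<union> {of_int n..of_int n + 1}
        = {of_int n - 1..of_int n + 1 :: real}"
      by auto
    finally have "continuous_on {of_int n - 1..of_int n + 1} F" .
    moreover have "x \<in> interior {of_int n - 1..of_int n + 1}"
      unfolding n_def by (simp, linarith)
    ultimately show ?thesis
      by (rule continuous_on_interior)
  qed
  thus ?thesis
    by (simp add: continuous_on_eq_continuous_at)
qed

text \<open>On each closed unit interval the composite is a translate of \<open>p\<close>; at the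
  right endpoint, where \<open>frac\<close> jumps back to 0, this rests on \<open>p 0 = p 1\<close>.
  It yields the periodic extension \<open>P\<close>.\<close>

lemma continuous_on_frac_compose:
  fixes p :: "real \<Rightarrow> 'a :: topological_space"
  assumes "continuous_on {0..1} p" and "p 0 = p 1"
  shows "continuous_on UNIV (\<lambda>t. p (frac t))"
proof (rule continuous_on_unit_intervals)
  fix n :: int
  have "continuous_on {of_int n..of_int n + 1} (\<lambda>t. p (t - of_int n))"
    by (rule continuous_on_compose2[OF assms(1)]) (auto intro!: continuous_intros)
  moreover have "p (t - of_int n) = p (frac t)" if "t \<in> {of_int n..of_int n + 1}" for t
  proof (cases "t = of_int n + 1")
    case True
    hence "frac t = 0" by (simp add: frac_eq_0_iff)
    thus ?thesis using True assms(2) by simp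
  next
    case False
    hence "\<lfloor>t\<rfloor> = n" using that by (auto simp: floor_eq_iff)
    thus ?thesis by (simp add: frac_def)
  qed
  ultimately show "continuous_on {of_int n..of_int n + 1} (\<lambda>t. p (frac t))"
    by (rule continuous_on_eq)
qed

section \<open>Truncated Mellin transforms\<close>

text \<open>Domination by \<open>C * x powr e\<close>, whose integral over the tail is explicit. The
  error bound depends on \<open>h\<close> only through \<open>C\<close> and \<open>e\<close>, which
  later gives convergence uniform in the Mellin variable.\<close>

lemma integral_powr_tail:
  fixes h :: "real \<Rightarrow> complex"
  assumes cont: "continuous_on {1..} h"
    and bound: "\<And>x. x \<ge> 1 \<Longrightarrow> norm (h x) \<le> C * x powr e"
    and e: "e < -1" and N: "N \<ge> 1"
  shows "h absolutely_integrable_on {1..}"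
    and "norm (integral {1..} h - integral {1..N} h) \<le> C * N powr (e + 1) / (-e - 1)"
proof -
  have dom: "((\<lambda>x. C * x powr e) has_integral C * (-(a powr (e+1)) / (e+1))) {a..}"
    if "a \<ge> 1" for a
    using has_integral_powr_to_inf[of e a] e that by (intro has_integral_mult_right) auto
  have meas: "h \<in> borel_measurable (lebesgue_on {a..})" if "a \<ge> 1" for a
    using continuous_on_subset[OF cont, of "{a..}"] that
    by (intro continuous_imp_measurable_on_sets_lebesgue) auto
  have abs_int: "h absolutely_integrable_on {a..}" if "a \<ge> 1" for a
    by (rule measurable_bounded_by_integrable_imp_absolutely_integrable
          [OF meas[OF that] _ has_integral_integrable[OF dom[OF that]]])
       (use bound that in auto)
  show "h absolutely_integrable_on {1..}"
    by (rule abs_int) simp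
  have "(h has_integral integral {1..N} h) {1..N}"
    by (intro integrable_integral integrable_continuous_interval continuous_on_subset[OF cont]) auto
  moreover have "(h has_integral integral {N..} h) {N..}"
    using abs_int[OF N] by (simp add: integrable_integral set_lebesgue_integral_eq_integral(1))
  moreover have "negligible ({1..N} \<inter> {N..})"
    by (rule negligible_subset[of "{N}"]) auto
  ultimately have "(h has_integral integral {1..N} h + integral {N..} h) ({1..N} \<union> {N..})"
    by (rule has_integral_Un)
  moreover have "{1..N} \<union> {N..} = {1..}"
    using N by auto
  ultimately have "integral {1..} h = integral {1..N} h + integral {N..} h"
    by (simp add: integral_unique)
  moreover have "norm (integral {N..} h) \<le> C * (-(N powr (e+1)) / (e+1))"
    by (rule integral_norm_bound_integral'[OF _ meas[OF N] _ dom[OF N]]) (use bound N in auto)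
  moreover have "C * (-(N powr (e+1)) / (e+1)) = C * N powr (e + 1) / (-e - 1)"
    using e by (simp add: field_simps)
  ultimately show "norm (integral {1..} h - integral {1..N} h) \<le> C * N powr (e + 1) / (-e - 1)"
    by simp
qed

lemma tendsto_two_power_neg_powr:
  assumes "e < 0"
  shows "(\<lambda>n::nat. (2 ^ n :: real) powr e) \<longlonglongrightarrow> 0"
proof -
  have "(2 ^ n) powr e = (2 powr e) ^ n" for n :: nat
    by (simp add: powr_power powr_powr mult.commute flip: powr_realpow)
  moreover have "2 powr e < (1 :: real)"
    using powr_less_mono[of e 0 2] assms by simp
  ultimately show ?thesis
    by (simp add: LIMSEQ_realpow_zero)
qed

text \<open>Truncation at powers of two is chosen to match partial sums over the blocks from
  \<open>2 ^ j\<close> to \<open>2 ^ Suc j\<close>.\<close>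

lemma tendsto_integral_dyadic:
  fixes h :: "real \<Rightarrow> complex"
  assumes "continuous_on {1..} h" and "\<And>x. x \<ge> 1 \<Longrightarrow> norm (h x) \<le> C * x powr e" and "e < -1"
  shows "(\<lambda>n. integral {1..2 ^ n} h) \<longlonglongrightarrow> integral {1..} h"
proof -
  have "(\<lambda>n::nat. C * (2 ^ n) powr (e + 1) / (-e - 1)) \<longlonglongrightarrow> C * 0 / (-e - 1)"
    using assms(3)
    by (intro tendsto_intros tendsto_two_power_neg_powr) auto
  hence "(\<lambda>n::nat. C * (2 ^ n) powr (e + 1) / (-e - 1)) \<longlonglongrightarrow> 0" by simp
  hence "(\<lambda>n. integral {1..} h - integral {1..2 ^ n} h) \<longlonglongrightarrow> 0"
    by (rule Lim_null_comparison[rotated])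
       (intro always_eventually allI integral_powr_tail(2)[OF assms]; simp)
  from tendsto_diff[OF tendsto_const[of "integral {1..} h"] this] show ?thesis by simp
qed

lemma continuous_on_mellin_integrand:
  assumes "continuous_on A h" and "A \<subseteq> {0<..}"
  shows "continuous_on A (mellin_integrand h s)"
  unfolding mellin_integrand_def using assms
  by (intro continuous_intros) (auto simp: complex_nonpos_Reals_iff)

text \<open>Keeping \<open>\<sigma>\<close> apart from \<open>Re s\<close> allows one bound for all
  \<open>s\<close> in a closed disc.\<close>

lemma norm_mellin_integrand_le:
  assumes "\<bar>h x\<bar> \<le> C * x powr -\<delta>" and "x \<ge> 1" and "Re s \<le> \<sigma>" and "C \<ge> 0"
  shows "norm (mellin_integrand h s x) \<le> C * x powr (\<sigma> - \<delta> - 1)"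
proof -
  have "norm (mellin_integrand h s x) = \<bar>h x\<bar> * x powr (Re s - 1)"
    using assms by (simp add: mellin_integrand_def norm_mult norm_powr_real_powr)
  also have "\<dots> \<le> (C * x powr -\<delta>) * x powr (\<sigma> - 1)"
    using assms by (intro mult_mono powr_mono) auto
  also have "\<dots> = C * x powr (\<sigma> - \<delta> - 1)"
    by (simp add: powr_add[symmetric] algebra_simps)
  finally show ?thesis .
qed

text \<open>Differentiation under the integral sign over a compact interval; the derivative of the
  kernel in \<open>s\<close> brings down a factor \<open>Ln x\<close>.\<close>

lemma holomorphic_mellin_truncated:
  assumes "continuous_on {1..} h"
  shows "(\<lambda>s. integral {1..N} (mellin_integrand h s)) holomorphic_on UNIV"
proof -
  have cont: "continuous_on {1..N} h"
    by (rule continuous_on_subset[OF assms]) auto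
  have "(\<lambda>s. integral (cbox 1 N) (mellin_integrand h s)) holomorphic_on UNIV"
  proof (rule leibniz_rule_holomorphic
      [where fx = "\<lambda>s x. of_real (h x) * (Ln (of_real x) * of_real x powr (s - 1))"])
    fix s :: complex and x :: real
    assume "x \<in> cbox 1 N"
    hence "((\<lambda>s. of_real x powr (s - 1)) has_field_derivative
        Ln (of_real x) * of_real x powr (s - 1) * 1) (at s)"
      by (intro DERIV_chain2[OF has_field_derivative_powr_right]) (auto intro!: derivative_eq_intros)
    thus "((\<lambda>s. mellin_integrand h s x) has_field_derivative
        of_real (h x) * (Ln (of_real x) * of_real x powr (s - 1))) (at s within UNIV)"
      unfolding mellin_integrand_def
      by (auto intro!: DERIV_cmult)
  next
    fix s
    show "mellin_integrand h s integrable_on cbox 1 N"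
      by (auto intro!: integrable_continuous_interval continuous_on_mellin_integrand[OF cont])
  next
    have "continuous_on (UNIV \<times> cbox 1 N) (\<lambda>p :: complex \<times> real. h (snd p))"
      by (rule continuous_on_compose2[OF cont]) (auto intro!: continuous_intros)
    thus "continuous_on (UNIV \<times> cbox 1 N)
        (\<lambda>(s, x). of_real (h x) * (Ln (of_real x) * of_real x powr (s - 1)))"
      unfolding case_prod_unfold
      by (intro continuous_intros) (auto simp: complex_nonpos_Reals_iff)
  qed auto
  thus ?thesis by simp
qed

lemma mellin_absolutely_integrable:
  assumes "continuous_on {1..} h" and "\<And>x. x \<ge> 1 \<Longrightarrow> \<bar>h x\<bar> \<le> C * x powr -\<delta>" and "C \<ge> 0"
    and "Re s < \<delta>"
  shows "mellin_integrand h s absolutely_integrable_on {1..}"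
  \<comment> \<open>\<open>N = 1\<close> is a dummy value: the integrability statement does not
    mention the cut-off.\<close>
  by (rule integral_powr_tail(1)[OF continuous_on_mellin_integrand[OF assms(1)]
        norm_mellin_integrand_le[OF assms(2) _ order.refl assms(3)], where N = 1])
     (use assms in auto)

lemma tendsto_mellin_dyadic:
  assumes "continuous_on {1..} h" and "\<And>x. x \<ge> 1 \<Longrightarrow> \<bar>h x\<bar> \<le> C * x powr -\<delta>" and "C \<ge> 0"
    and "Re s < \<delta>"
  shows "(\<lambda>n. integral {1..2 ^ n} (mellin_integrand h s)) \<longlonglongrightarrow> mellin h s"
  unfolding mellin_def
  by (rule tendsto_integral_dyadic[OF continuous_on_mellin_integrand[OF assms(1)]
        norm_mellin_integrand_le[OF assms(2) _ order.refl assms(3)]])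
     (use assms in auto)

text \<open>The truncated transforms are entire and converge locally uniformly on the
  half-plane.\<close>

lemma holomorphic_mellin:
  assumes cont: "continuous_on {1..} h" and bound: "\<And>x. x \<ge> 1 \<Longrightarrow> \<bar>h x\<bar> \<le> C * x powr -\<delta>"
    and C: "C \<ge> 0"
  shows "mellin h holomorphic_on {s. Re s < \<delta>}"
proof (rule holomorphic_uniform_sequence
    [where f = "\<lambda>n s. integral {1..2 ^ n} (mellin_integrand h s)"])
  show "open {s. Re s < \<delta>}"
    by (simp add: open_halfspace_Re_lt)
  show "(\<lambda>s. integral {1..2 ^ n} (mellin_integrand h s)) holomorphic_on {s. Re s < \<delta>}" for n
    using holomorphic_mellin_truncated[OF cont] by (rule holomorphic_on_subset) simp
next
  fix z assume z: "z \<in> {s. Re s < \<delta>}"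
  \<comment> \<open>The radius is half the distance from \<open>z\<close> to the boundary line, and
    \<open>e\<close> is the largest exponent of the majorant on the disc. It equals
    \<open>-d - 1\<close>, so it stays below -1.\<close>
  define d where "d = (\<delta> - Re z) / 2"
  define e where "e = Re z + d - \<delta> - 1"
  have d: "d > 0" and e: "e < -1"
    using z by (auto simp: d_def e_def field_simps)
  have Re_le: "Re s \<le> Re z + d" if "s \<in> cball z d" for s
    using that abs_Re_le_cmod[of "z - s"] by (auto simp: dist_norm)
  have "cball z d \<subseteq> {s. Re s < \<delta>}"
    using Re_le z by (force simp: d_def field_simps)
  moreover have "uniform_limit (cball z d)
      (\<lambda>n s. integral {1..2 ^ n} (mellin_integrand h s)) (mellin h) sequentially"
  proof (rule uniform_limitI)
    fix r :: real assume r: "r > 0"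
    have "(\<lambda>n::nat. C * (2 ^ n) powr (e + 1) / (-e - 1)) \<longlonglongrightarrow> C * 0 / (-e - 1)"
      using e
      by (intro tendsto_intros tendsto_two_power_neg_powr) auto
    hence "\<forall>\<^sub>F n :: nat in sequentially. C * (2 ^ n) powr (e + 1) / (-e - 1) < r"
      using r by (intro order_tendstoD(2)) auto
    thus "\<forall>\<^sub>F n in sequentially. \<forall>s\<in>cball z d.
        dist (integral {1..2 ^ n} (mellin_integrand h s)) (mellin h s) < r"
    proof eventually_elim
      case (elim n)
      show ?case
      proof
        fix s assume s: "s \<in> cball z d"
        have "norm (mellin h s - integral {1..2 ^ n} (mellin_integrand h s))
            \<le> C * (2 ^ n) powr (e + 1) / (-e - 1)"
          unfolding mellin_def e_def
          by (rule integral_powr_tail(2)[OF continuous_on_mellin_integrand[OF cont]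
                norm_mellin_integrand_le[OF bound _ Re_le[OF s] C]])
             (use e in \<open>auto simp: e_def\<close>)
        thus "dist (integral {1..2 ^ n} (mellin_integrand h s)) (mellin h s) < r"
          using elim by (simp add: dist_norm norm_minus_commute)
      qed
    qed
  qed
  ultimately show "\<exists>d>0. cball z d \<subseteq> {s. Re s < \<delta>} \<and> uniform_limit (cball z d)
      (\<lambda>n s. integral {1..2 ^ n} (mellin_integrand h s)) (mellin h) sequentially"
    using d by blast
qed

lemma mellin_one:
  assumes "Re s < 0"
  shows "mellin (\<lambda>_. 1) s = - 1 / s"
proof -
  have s: "s \<noteq> 0" using assms by auto
  have eq: "integral {1..2 ^ n} (mellin_integrand (\<lambda>_. 1) s)
      = of_real (2 ^ n) powr s / s - 1 / s" for n :: nat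
  proof -
    have "(mellin_integrand (\<lambda>_. 1) s has_integral
        (of_real (2 ^ n) powr s / s - of_real 1 powr s / s)) {1..2 ^ n}"
    proof (rule fundamental_theorem_of_calculus)
      fix x :: real assume "x \<in> {1..2 ^ n}"
      hence "((\<lambda>z. z powr s / s) has_field_derivative mellin_integrand (\<lambda>_. 1) s x) (at (of_real x))"
        using s by (auto intro!: derivative_eq_intros has_field_derivative_powr
            simp: mellin_integrand_def complex_nonpos_Reals_iff)
      from has_vector_derivative_real_field[OF this]
      show "((\<lambda>x. of_real x powr s / s) has_vector_derivative mellin_integrand (\<lambda>_. 1) s x)
          (at x within {1..2 ^ n})" .
    qed auto
    thus ?thesis by (simp add: integral_unique)
  qed
  have "(\<lambda>n::nat. (2 ^ n) powr Re s) \<longlonglongrightarrow> 0"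
    using assms by (rule tendsto_two_power_neg_powr)
  hence "(\<lambda>n::nat. complex_of_real (2 ^ n) powr s) \<longlonglongrightarrow> 0"
    by (intro tendsto_norm_zero_cancel[where f = "\<lambda>n. complex_of_real (2 ^ n) powr s"])
       (simp add: norm_powr_real_powr del: of_real_power)
  hence "(\<lambda>n::nat. of_real (2 ^ n) powr s / s - 1 / s) \<longlonglongrightarrow> 0 / s - 1 / s"
    using s by (intro tendsto_intros) auto
  moreover have "(\<lambda>n. integral {1..2 ^ n} (mellin_integrand (\<lambda>_. 1) s)) \<longlonglongrightarrow> mellin (\<lambda>_. 1) s"
    \<comment> \<open>The constant function 1 decays with exponent 0, hence the half-plane
      \<open>Re s < 0\<close>.\<close>
    by (rule tendsto_mellin_dyadic[where C = 1 and \<delta> = 0]) (use assms in auto)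
  ultimately show ?thesis
    unfolding eq using LIMSEQ_unique by fastforce
qed

text \<open>The Laurent series of \<open>G\<close> at \<open>z\<close> is the Taylor series of
  \<open>M\<close> minus the inverse of the variable. Its order is therefore -1, and its constant
  term is that of the Taylor series.\<close>

lemma simple_pole_extension:
  fixes M :: "complex \<Rightarrow> complex" and z :: complex
  assumes hol: "M holomorphic_on A" and A: "open A" and z: "z \<in> A"
  defines "G \<equiv> \<lambda>s. M s - 1 / (s - z)"
  shows "G meromorphic_on A" and "G holomorphic_on A - {z}" and "is_pole G z"
    and "zorder G z = -1" and "finite_value G z = M z"
proof -
  have ana: "M analytic_on A"
    using hol A by (simp add: analytic_on_open)
  show "G meromorphic_on A"
    unfolding G_def by (intro meromorphic_intros analytic_on_imp_meromorphic_on[OF ana])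
  show "G holomorphic_on A - {z}"
    unfolding G_def by (intro holomorphic_intros holomorphic_on_subset[OF hol]) auto
  define F where "F = fps_to_fls (fps_expansion M z) - fls_X_inv"
  have "(\<lambda>w. M (z + w)) has_laurent_expansion fps_to_fls (fps_expansion M z)"
    by (intro has_laurent_expansion_fps analytic_at_imp_has_fps_expansion analytic_on_subset[OF ana])
       (use z in auto)
  hence "(\<lambda>w. M (z + w) - inverse w) has_laurent_expansion F"
    unfolding F_def by (intro laurent_expansion_intros)
  hence F: "(\<lambda>w. G (z + w)) has_laurent_expansion F"
    by (simp add: G_def field_simps)
  have "fls_subdegree F = -1"
    by (rule fls_subdegree_eqI) (auto simp: F_def)
  thus "is_pole G z" and "zorder G z = -1"
    using has_laurent_expansion_imp_is_pole[OF F] has_laurent_expansion_zorder[OF F] by force+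
  show "finite_value G z = M z"
    unfolding finite_value_def laurent_expansion_eqI[OF F]
    by (simp add: F_def fps_expansion_def)
qed

section \<open>Dyadic sums and their Fourier coefficients\<close>

text \<open>The numbers \<open>chi k\<close> are chosen so that Mellin kernels become Fourier
  characters in the variable \<open>log 2 x\<close>.\<close>

lemma powr_chi:
  "complex_of_real (2 powr t) powr (- chi k) = exp (- 2 * of_int k * of_real pi * \<i> * of_real t)"
proof -
  have "complex_of_real (2 powr t) powr (- chi k) = exp (- chi k * of_real (t * ln 2))"
    by (simp add: powr_def Ln_of_real ln_powr)
  also have "- chi k * of_real (t * ln 2) = - 2 * of_int k * of_real pi * \<i> * of_real t"
    by (simp add: chi_def field_simps)
  finally show ?thesis .
qed

lemma exp_two_pi_i_shift:
  fixes k :: int and j :: nat and t :: real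
  shows "exp (- 2 * of_int k * of_real pi * \<i> * of_real (real j + t))
    = exp (- 2 * of_int k * of_real pi * \<i> * of_real t)"
proof -
  have "exp (2 * of_real pi * \<i> * of_int (k * int j)) = 1"
    using exp_integer_2pi[of "of_int (k * int j)"] by (simp add: mult_ac)
  hence "exp (- (2 * of_real pi * \<i> * of_int (k * int j))) = 1"
    by (simp add: exp_minus)
  moreover have "- 2 * of_int k * of_real pi * \<i> * of_real (real j + t)
      = - (2 * of_real pi * \<i> * of_int (k * int j)) + - 2 * of_int k * of_real pi * \<i> * of_real t"
    by (simp add: algebra_simps)
  ultimately show ?thesis
    by (simp only: exp_add mult_1_left)
qed

text \<open>Substituting \<open>x = 2 powr (j + t)\<close>, the factor \<open>x\<close> from the
  differential raises the kernel exponent \<open>- chi k - 1\<close> to \<open>- chi k\<close>. The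
  resulting character has period 1 in \<open>t\<close>, so \<open>j\<close> drops out of it.\<close>

lemma has_integral_dyadic_substitution:
  fixes h :: "real \<Rightarrow> real" and j :: nat
  assumes "continuous_on {2 ^ j..2 ^ Suc j} h"
  shows "((\<lambda>t. of_real (h (2 powr (real j + t))) * exp (- 2 * of_int k * of_real pi * \<i> * of_real t))
    has_integral integral {2 ^ j..2 ^ Suc j} (mellin_integrand h (- chi k)) / of_real (ln 2)) {0..1}"
proof -
  define b where "b = (\<lambda>t. 2 powr (real j + t))"
  have b01: "b 0 = 2 ^ j" "b 1 = 2 ^ Suc j"
    by (simp_all add: b_def powr_realpow powr_add)
  have "((\<lambda>t. (ln 2 * b t) *\<^sub>R mellin_integrand h (- chi k) (b t)) has_integral
      integral {b 0..b 1} (mellin_integrand h (- chi k))) {0..1}"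
  proof (rule has_integral_substitution[where c = "b 0" and d = "b 1"])
    show "continuous_on {b 0..b 1} (mellin_integrand h (- chi k))"
      using assms unfolding b01
      by (intro continuous_on_mellin_integrand) (auto intro: less_le_trans[of _ "2 ^ j"])
    show "(b has_field_derivative ln 2 * b t) (at t within {0..1})" for t
      unfolding b_def powr_def by (auto intro!: derivative_eq_intros)
  qed (auto simp: b_def)
  from has_integral_divide[OF this, of "of_real (ln 2)"]
  have "((\<lambda>t. (ln 2 * b t) *\<^sub>R mellin_integrand h (- chi k) (b t) / of_real (ln 2)) has_integral
      integral {2 ^ j..2 ^ Suc j} (mellin_integrand h (- chi k)) / of_real (ln 2)) {0..1}"
    unfolding b01 .
  moreover have "(ln 2 * b t) *\<^sub>R mellin_integrand h (- chi k) (b t) / of_real (ln 2)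
      = of_real (h (b t)) * exp (- 2 * of_int k * of_real pi * \<i> * of_real t)" for t
  proof -
    have "of_real (b t) powr (- chi k) = exp (- 2 * of_int k * of_real pi * \<i> * of_real t)"
      unfolding b_def powr_chi exp_two_pi_i_shift ..
    moreover have "complex_of_real (b t) powr (- chi k) = of_real (b t) * of_real (b t) powr (- chi k - 1)"
      by (simp add: powr_diff b_def)
    ultimately show ?thesis
      by (simp add: mellin_integrand_def scaleR_conv_of_real)
  qed
  ultimately show ?thesis
    by (simp add: b_def)
qed

lemma integral_mellin_integrand_dyadic_sum:
  assumes "continuous_on {1..} h"
  shows "(\<Sum>j<n. integral {2 ^ j..2 ^ Suc j} (mellin_integrand h s))
    = integral {1..2 ^ n} (mellin_integrand h s)"
proof (induction n)
  case (Suc n)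
  have "continuous_on {1..2 ^ Suc n} (mellin_integrand h s)"
    by (rule continuous_on_mellin_integrand) (auto intro: continuous_on_subset[OF assms])
  from Henstock_Kurzweil_Integration.integral_combine[OF _ _ integrable_continuous_interval[OF this], of "2 ^ n"]
  show ?case using Suc by simp
qed simp

text \<open>The factor \<open>x powr -\<delta>\<close> is retained because it supplies the decay of
  the tail series, hence the smallness of \<open>Q\<close>.\<close>

lemma dyadic_term_le:
  fixes h :: "real \<Rightarrow> real"
  assumes "\<And>x. x \<ge> 1 \<Longrightarrow> \<bar>h x\<bar> \<le> C * x powr -\<delta>" and "x \<ge> 1"
  shows "\<bar>h (2 ^ j * x)\<bar> \<le> C * x powr -\<delta> * (2 powr -\<delta>) ^ j"
proof -
  have "1 \<le> 2 ^ j * x"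
    using mult_mono[of 1 "2 ^ j" 1 x] assms(2) by simp
  from assms(1)[OF this] have "\<bar>h (2 ^ j * x)\<bar> \<le> C * (2 ^ j * x) powr -\<delta>" .
  also have "(2 ^ j * x) powr -\<delta> = x powr -\<delta> * (2 powr -\<delta>) ^ j"
    using assms(2) by (simp add: powr_mult powr_power powr_powr mult.commute flip: powr_realpow)
  finally show ?thesis by (simp add: mult_ac)
qed

text \<open>Here the decay in \<open>t\<close> is given up for a majorant independent of
  \<open>t\<close>, as the Weierstrass M-test requires.\<close>

lemma dyadic_term_le_unit:
  fixes h :: "real \<Rightarrow> real"
  assumes "\<And>x. x \<ge> 1 \<Longrightarrow> \<bar>h x\<bar> \<le> C * x powr -\<delta>" and "C \<ge> 0" and "\<delta> > 0" and "t \<ge> 0"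
  shows "\<bar>h (2 powr (real j + t))\<bar> \<le> C * (2 powr -\<delta>) ^ j"
proof -
  have x: "2 powr t \<ge> (1::real)" using assms(4) by (simp add: ge_one_powr_ge_zero)
  have "\<bar>h (2 ^ j * 2 powr t)\<bar> \<le> C * (2 powr t) powr -\<delta> * (2 powr -\<delta>) ^ j"
    by (rule dyadic_term_le[OF assms(1) x])
  also have "\<dots> \<le> C * 1 * (2 powr -\<delta>) ^ j"
    using powr_mono[of "-\<delta>" 0 "2 powr t"] x assms by (intro mult_mono) auto
  finally show ?thesis
    by (simp add: powr_add powr_realpow)
qed

lemma summable_dyadic_geometric:
  assumes "(\<delta> :: real) > 0"
  shows "summable (\<lambda>j::nat. C * (2 powr -\<delta> :: real) ^ j)"
proof -
  have "2 powr -\<delta> < (1 :: real)"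
    using powr_less_mono[of "-\<delta>" 0 2] assms by simp
  thus ?thesis
    by (intro summable_mult summable_geometric) auto
qed

lemma summable_dyadic:
  fixes h :: "real \<Rightarrow> real"
  assumes "\<And>x. x \<ge> 1 \<Longrightarrow> \<bar>h x\<bar> \<le> C * x powr -\<delta>" and "\<delta> > 0" and "x \<ge> 1"
  shows "summable (\<lambda>j. h (2 ^ j * x))"
  by (rule summable_comparison_test'[OF summable_dyadic_geometric[OF assms(2)], where N = 0])
     (use dyadic_term_le[OF assms(1,3)] in auto)

lemma continuous_on_dyadic_term:
  fixes j :: nat
  assumes "continuous_on {1..} h"
  shows "continuous_on {0..1} (\<lambda>t. h (2 powr (real j + t)))"
  by (rule continuous_on_compose2[OF assms])
     (auto intro!: continuous_intros simp: ge_one_powr_ge_zero)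

lemma continuous_on_dyadic_sum:
  fixes h :: "real \<Rightarrow> real"
  assumes cont: "continuous_on {1..} h" and bound: "\<And>x. x \<ge> 1 \<Longrightarrow> \<bar>h x\<bar> \<le> C * x powr -\<delta>"
    and C: "C \<ge> 0" and \<delta>: "\<delta> > 0"
  shows "continuous_on {0..1} (\<lambda>t. \<Sum>j. h (2 powr (real j + t)))"
proof -
  have "uniform_limit {0..1} (\<lambda>n t. \<Sum>j<n. h (2 powr (real j + t)))
      (\<lambda>t. \<Sum>j. h (2 powr (real j + t))) sequentially"
    by (rule Weierstrass_m_test[OF _ summable_dyadic_geometric[OF \<delta>]])
       (use dyadic_term_le_unit[OF bound C \<delta>] in auto)
  thus ?thesis
    by (rule uniform_limit_theorem[rotated])
       (auto intro!: always_eventually continuous_on_sum continuous_on_dyadic_term[OF cont])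
qed

text \<open>Uniform convergence permits termwise integration, and the blocks assemble to Mellin
  integrals over \<open>{1..2 ^ n}\<close>. The limit exists because \<open>- chi k\<close> has real
  part 0, which is below \<open>\<delta>\<close>.\<close>

lemma has_integral_dyadic_sum:
  fixes h :: "real \<Rightarrow> real"
  assumes cont: "continuous_on {1..} h" and bound: "\<And>x. x \<ge> 1 \<Longrightarrow> \<bar>h x\<bar> \<le> C * x powr -\<delta>"
    and C: "C \<ge> 0" and \<delta>: "\<delta> > 0"
  shows "((\<lambda>t. of_real (\<Sum>j. h (2 powr (real j + t))) *
      exp (- 2 * of_int k * of_real pi * \<i> * of_real t)) has_integral
      mellin h (- chi k) / of_real (ln 2)) {0..1}"
proof -
  define E where "E = (\<lambda>t. exp (- 2 * of_int k * of_real pi * \<i> * complex_of_real t))"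
  define u where "u = (\<lambda>(j::nat) t. of_real (h (2 powr (real j + t))) * E t)"
  have norm_E: "norm (E t) = 1" for t
    by (simp add: E_def)
  have sum_u: "(\<Sum>j. u j t) = of_real (\<Sum>j. h (2 powr (real j + t))) * E t" if "t \<ge> 0" for t
  proof -
    have "summable (\<lambda>j. h (2 ^ j * 2 powr t))"
      using that by (intro summable_dyadic[OF bound \<delta>]) (auto simp: ge_one_powr_ge_zero)
    hence "summable (\<lambda>j. h (2 powr (real j + t)))"
      by (simp add: powr_add powr_realpow)
    thus ?thesis
      by (simp add: u_def suminf_mult2[symmetric] suminf_of_real summable_of_real)
  qed
  have "uniform_limit {0..1} (\<lambda>n t. \<Sum>j<n. u j t) (\<lambda>t. \<Sum>j. u j t) sequentially"
    by (rule Weierstrass_m_test[OF _ summable_dyadic_geometric[OF \<delta>]])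
       (use dyadic_term_le_unit[OF bound C \<delta>] in \<open>auto simp: u_def norm_mult norm_E\<close>)
  moreover have "continuous_on {0..1} (\<lambda>t. \<Sum>j<n. u j t)" for n
    unfolding u_def E_def
    by (intro continuous_intros continuous_on_dyadic_term[OF cont])
  \<comment> \<open>The integrals \<open>I n\<close> and the limit \<open>J\<close> are abstract at
    this point; uniqueness of integrals and of limits identifies them below.\<close>
  ultimately obtain I J where I: "\<And>n. ((\<lambda>t. \<Sum>j<n. u j t) has_integral I n) {0..1}"
      and J: "((\<lambda>t. \<Sum>j. u j t) has_integral J) {0..1}" and lim: "I \<longlonglongrightarrow> J"
    by (rule uniform_limit_integral) auto
  have "((\<lambda>t. \<Sum>j<n. u j t) has_integral
      (\<Sum>j<n. integral {2 ^ j..2 ^ Suc j} (mellin_integrand h (- chi k)) / of_real (ln 2))) {0..1}"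
    for n
    unfolding u_def E_def
    by (intro has_integral_sum has_integral_dyadic_substitution continuous_on_subset[OF cont])
       (auto intro: order_trans[of _ "2 ^ _"])
  hence "I = (\<lambda>n. integral {1..2 ^ n} (mellin_integrand h (- chi k)) / of_real (ln 2))"
    using has_integral_unique[OF I]
    by (simp add: fun_eq_iff integral_mellin_integrand_dyadic_sum[OF cont]
        flip: sum_divide_distrib power_Suc)
  moreover have "(\<lambda>n. integral {1..2 ^ n} (mellin_integrand h (- chi k)) / of_real (ln 2))
      \<longlonglongrightarrow> mellin h (- chi k) / of_real (ln 2)"
    using \<delta> by (intro tendsto_divide tendsto_const tendsto_mellin_dyadic[OF cont bound C])
               (auto simp: chi_def)
  ultimately have "J = mellin h (- chi k) / of_real (ln 2)"
    using LIMSEQ_unique[OF lim] by metis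
  with J have "((\<lambda>t. \<Sum>j. u j t) has_integral mellin h (- chi k) / of_real (ln 2)) {0..1}"
    by simp
  thus ?thesis
    by (rule has_integral_eq[rotated]) (auto simp: sum_u E_def)
qed

text \<open>This is the contribution of the summand \<open>1 - t\<close> of one period of
  \<open>P\<close>.\<close>

lemma has_integral_sawtooth:
  fixes k :: int
  shows "((\<lambda>t. of_real (1 - t) * exp (- 2 * of_int k * of_real pi * \<i> * of_real t)) has_integral
    (if k = 0 then 1 / 2 else 1 / (of_real (ln 2) * chi k))) {0..1}"
proof (cases "k = 0")
  case True
  have "((\<lambda>t::real. 1 - t) has_integral (1 - 1\<^sup>2 / 2) - (0 - 0\<^sup>2 / 2)) {0..1}"
    by (rule fundamental_theorem_of_calculus)
       (auto intro!: derivative_eq_intros simp flip: has_real_derivative_iff_has_vector_derivative)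
  hence "((\<lambda>t. complex_of_real (1 - t)) has_integral of_real ((1 - 1\<^sup>2 / 2) - (0 - 0\<^sup>2 / 2))) {0..1}"
    by (rule has_integral_of_real)
  thus ?thesis
    using True by simp
next
  case False
  define c where "c = 2 * of_int k * of_real pi * \<i>"
  have c: "c \<noteq> 0" using False by (simp add: c_def)
  \<comment> \<open>A primitive found by integration by parts. Since \<open>exp (- c) = 1\<close>,
    the terms in \<open>1 / c ^ 2\<close> cancel between the endpoints.\<close>
  define F where "F = (\<lambda>z. exp (- c * z) * (1 / c ^ 2 - (1 - z) / c))"
  have "((\<lambda>t. (1 - of_real t) * exp (- c * of_real t)) has_integral
      F (of_real 1) - F (of_real 0)) {0..1}"
  proof (rule fundamental_theorem_of_calculus)
    fix t :: real
    have "(F has_field_derivative (1 - of_real t) * exp (- c * of_real t)) (at (of_real t))"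
      unfolding F_def using c
      by (auto intro!: derivative_eq_intros simp: field_simps power2_eq_square)
    from has_vector_derivative_real_field[OF this]
    show "((\<lambda>t. F (of_real t)) has_vector_derivative (1 - of_real t) * exp (- c * of_real t))
        (at t within {0..1})" .
  qed auto
  moreover have "exp (- c) = 1"
    using exp_two_pi_i_shift[of k 1 0] by (simp add: c_def)
  hence "F (of_real 1) - F (of_real 0) = 1 / c"
    using c by (simp add: F_def field_simps)
  moreover have "of_real (ln 2) * chi k = c"
    by (simp add: chi_def c_def)
  ultimately show ?thesis
    using False by (simp add: c_def)
qed

section \<open>Interpolation of divide-and-conquer recurrences\<close>

lemma interpolate_of_nat:
  assumes "\<phi> 0 = 0" and "n \<ge> 1"
  shows "interpolate \<phi> g (real n) = g n"
  using assms by (simp add: interpolate_def frac_def)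

text \<open>The definition through \<open>frac\<close> assigns \<open>t = 1\<close> to the next
  interval. The end values of \<open>\<phi>\<close> make both descriptions agree, so the formula
  holds on closed intervals, as gluing needs.\<close>

lemma interpolate_add:
  assumes "\<phi> 0 = 0" and "\<phi> 1 = 1" and "n \<ge> 1" and "t \<in> {0..1}"
  shows "interpolate \<phi> g (real n + t) = (1 - \<phi> t) * g n + \<phi> t * g (n + 1)"
proof (cases "t = 1")
  case True
  have "real n + t = real (n + 1)" using True by simp
  thus ?thesis
    using True assms interpolate_of_nat[of \<phi> "n + 1" g] by (simp add: add.commute)
next
  case False
  hence "\<lfloor>real n + t\<rfloor> = int n"
    using assms by (auto simp: floor_eq_iff)
  thus ?thesis
    using assms by (simp add: interpolate_def frac_def)
qed

lemma nat_floor_frac_cases: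
  fixes x :: real
  assumes "x \<ge> 1"
  obtains n t where "n \<ge> 1" and "t \<in> {0..<1}" and "x = real n + t"
proof
  show "1 \<le> nat \<lfloor>x\<rfloor>" using assms by (simp add: le_nat_iff le_floor_iff)
  show "frac x \<in> {0..<1}" by (simp add: frac_lt_1)
  show "x = real (nat \<lfloor>x\<rfloor>) + frac x" using assms by (simp add: frac_def)
qed

lemma continuous_on_interpolate:
  assumes cont: "continuous_on {0..1} \<phi>" and \<phi>: "\<phi> 0 = 0" "\<phi> 1 = 1"
  shows "continuous_on {1..} (interpolate \<phi> g)"
proof -
  \<comment> \<open>Composing with \<open>max 1\<close> continues the function to the left of 1 by a
    constant, so that the gluing lemma on the whole line applies.\<close>
  have "continuous_on UNIV (\<lambda>x. interpolate \<phi> g (max 1 x))"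
  proof (rule continuous_on_unit_intervals)
    fix n :: int
    show "continuous_on {of_int n..of_int n + 1} (\<lambda>x. interpolate \<phi> g (max 1 x))"
    proof (cases "n \<ge> 1")
      case True
      define m where "m = nat n"
      have n: "of_int n = real m" and m: "m \<ge> 1" using True by (auto simp: m_def)
      have "continuous_on {real m..real m + 1} (\<lambda>x. \<phi> (x - real m))"
        by (rule continuous_on_compose2[OF cont]) (auto intro!: continuous_intros)
      hence "continuous_on {real m..real m + 1}
          (\<lambda>x. (1 - \<phi> (x - real m)) * g m + \<phi> (x - real m) * g (m + 1))"
        by (intro continuous_intros)
      thus ?thesis
        unfolding n
      proof (rule continuous_on_eq)
        fix x assume "x \<in> {real m..real m + 1}"
        thus "(1 - \<phi> (x - real m)) * g m + \<phi> (x - real m) * g (m + 1)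
            = interpolate \<phi> g (max 1 x)"
          using interpolate_add[OF \<phi> m, of "x - real m" g] m by (auto simp: max_def)
      qed
    next
      case False
      hence "max 1 x = 1" if "x \<in> {of_int n..of_int n + 1}" for x :: real
        using that by (auto simp: max_def)
      thus ?thesis
        by (auto intro: continuous_on_eq[OF continuous_on_const[of _ "interpolate \<phi> g 1"]])
    qed
  qed
  hence "continuous_on {1..} (\<lambda>x. interpolate \<phi> g (max 1 x))"
    by (rule continuous_on_subset) simp
  thus ?thesis
    by (rule continuous_on_eq) auto
qed

text \<open>For even \<open>\<lfloor>x\<rfloor>\<close> the point \<open>x / 2\<close> lies in the
  left half of its unit interval, for odd \<open>\<lfloor>x\<rfloor>\<close> in the right half. The
  two functional equations of \<open>\<phi>\<close> then reproduce exactly the weights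
  \<open>\<alpha>\<close> and \<open>\<beta>\<close> of the recurrence.\<close>

lemma interpolate_recurrence:
  assumes pos: "\<alpha> > 0" "\<beta> > 0" and \<phi>: "interpolation_fun \<alpha> \<beta> \<phi>"
    and rec: "\<And>n. n \<ge> 2 \<Longrightarrow>
      f n = \<alpha> * f (nat \<lfloor>real n / 2\<rfloor>) + \<beta> * f (nat \<lceil>real n / 2\<rceil>) + g n"
    and x: "x \<ge> 2"
  shows "interpolate \<phi> f x = (\<alpha> + \<beta>) * interpolate \<phi> f (x / 2) + interpolate \<phi> g x"
proof -
  have \<phi>01: "\<phi> 0 = 0" "\<phi> 1 = 1"
    using \<phi> by (auto simp: interpolation_fun_def)
  have \<phi>_left: "(\<alpha> + \<beta>) * \<phi> t = \<beta> * \<phi> (2 * t)" if "t \<in> {0..1/2}" for t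
  proof -
    have "\<phi> t = \<beta> / (\<alpha> + \<beta>) * \<phi> (2 * t)"
      using \<phi> that unfolding interpolation_fun_def by blast
    thus ?thesis using pos by simp
  qed
  have \<phi>_right: "(\<alpha> + \<beta>) * \<phi> t = \<alpha> * \<phi> (2 * t - 1) + \<beta>" if "t \<in> {1/2..1}" for t
  proof -
    have "\<phi> t = \<alpha> / (\<alpha> + \<beta>) * \<phi> (2 * t - 1) + \<beta> / (\<alpha> + \<beta>)"
      using \<phi> that unfolding interpolation_fun_def by blast
    thus ?thesis using pos by (simp add: distrib_left)
  qed
  have f_even: "f (2 * m) = (\<alpha> + \<beta>) * f m + g (2 * m)" if "m \<ge> 1" for m
    using rec[of "2 * m"] that by (simp add: algebra_simps)
  have f_odd: "f (2 * m + 1) = \<alpha> * f m + \<beta> * f (m + 1) + g (2 * m + 1)" if "m \<ge> 1" for m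
  proof -
    have "\<lfloor>real (2 * m + 1) / 2\<rfloor> = int m" "\<lceil>real (2 * m + 1) / 2\<rceil> = int (m + 1)"
      by (auto simp: floor_eq_iff ceiling_eq_iff)
    hence "nat \<lfloor>real (2 * m + 1) / 2\<rfloor> = m" "nat \<lceil>real (2 * m + 1) / 2\<rceil> = m + 1"
      by (simp_all only: nat_int)
    thus ?thesis using rec[of "2 * m + 1"] that by (simp only:)
  qed
  obtain n t where n: "n \<ge> 1" and t: "t \<in> {0..<1}" and x_eq: "x = real n + t"
    using nat_floor_frac_cases[of x] x by auto
  have n2: "n \<ge> 2" using x t x_eq by auto
  show ?thesis
  proof (cases "even n")
    case True
    then obtain m where m: "n = 2 * m" by blast
    have m1: "m \<ge> 1" using n2 m by simp
    have half: "x / 2 = real m + t / 2" using m x_eq by simp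
    have "(\<alpha> + \<beta>) * \<phi> (t / 2) = \<beta> * \<phi> t"
      using \<phi>_left[of "t / 2"] t by simp
    \<comment> \<open>The free factor \<open>c\<close> makes the functional equation a rewrite rule
      for the products with values of \<open>f\<close> that occur after expansion.\<close>
    hence *: "(\<alpha> + \<beta>) * (\<phi> (t / 2) * c) = \<beta> * \<phi> t * c" for c
      by (metis mult.assoc)
    have f2: "f (n + 1) = \<alpha> * f m + \<beta> * f (m + 1) + g (n + 1)"
      using f_odd[OF m1] m by simp
    have "(\<alpha> + \<beta>) * interpolate \<phi> f (x / 2)
        = (\<alpha> + \<beta>) * f m - (\<alpha> + \<beta>) * (\<phi> (t / 2) * f m) + (\<alpha> + \<beta>) * (\<phi> (t / 2) * f (m + 1))"
      unfolding half using t
      by (subst interpolate_add[OF \<phi>01 m1]) (auto simp: algebra_simps)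
    moreover have "interpolate \<phi> f x = (1 - \<phi> t) * f n + \<phi> t * f (n + 1)"
        "interpolate \<phi> g x = (1 - \<phi> t) * g n + \<phi> t * g (n + 1)"
      unfolding x_eq using interpolate_add[OF \<phi>01 n] t by auto
    ultimately show ?thesis
      unfolding f2 * using f_even[OF m1] m by (simp add: algebra_simps)
  next
    case False
    then obtain m where m: "n = 2 * m + 1" by (elim oddE)
    have m1: "m \<ge> 1" using n2 m by simp
    have half: "x / 2 = real m + (1 + t) / 2" using m x_eq by (simp add: field_simps)
    have "(\<alpha> + \<beta>) * \<phi> ((1 + t) / 2) = \<alpha> * \<phi> t + \<beta>"
      using \<phi>_right[of "(1 + t) / 2"] t by (simp add: add_divide_distrib)
    hence *: "(\<alpha> + \<beta>) * (\<phi> ((1 + t) / 2) * c) = (\<alpha> * \<phi> t + \<beta>) * c" for c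
      by (metis mult.assoc)
    have f2: "f (n + 1) = (\<alpha> + \<beta>) * f (m + 1) + g (n + 1)"
      using f_even[of "m + 1"] m by simp
    have "(\<alpha> + \<beta>) * interpolate \<phi> f (x / 2)
        = (\<alpha> + \<beta>) * f m - (\<alpha> + \<beta>) * (\<phi> ((1 + t) / 2) * f m)
          + (\<alpha> + \<beta>) * (\<phi> ((1 + t) / 2) * f (m + 1))"
      unfolding half using t
      by (subst interpolate_add[OF \<phi>01 m1]) (auto simp: algebra_simps)
    moreover have "interpolate \<phi> f x = (1 - \<phi> t) * f n + \<phi> t * f (n + 1)"
        "interpolate \<phi> g x = (1 - \<phi> t) * g n + \<phi> t * g (n + 1)"
      unfolding x_eq using interpolate_add[OF \<phi>01 n] t by auto
    ultimately show ?thesis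
      unfolding f2 * using f_odd[OF m1] m by (simp add: algebra_simps)
  qed
qed

text \<open>Base interval of the iteration: inserting \<open>f 2\<close> into the interpolation
  formula leaves \<open>\<phi> (x - 1) * g 2\<close>, which is all of the interpolated
  \<open>g\<close> because \<open>g 1 = 0\<close>.\<close>

lemma interpolate_initial:
  assumes "\<phi> 0 = 0" "\<phi> 1 = 1" and f2: "f 2 = (\<alpha> + \<beta>) * f 1 + g 2" and "g 1 = 0"
    and "x \<in> {1..<2}"
  shows "interpolate \<phi> f x = f 1 * (1 + (\<alpha> + \<beta> - 1) * \<phi> (x - 1)) + interpolate \<phi> g x"
  using assms interpolate_add[OF assms(1,2), of 1 "x - 1" f]
    interpolate_add[OF assms(1,2), of 1 "x - 1" g]
  by (simp add: f2 numeral_2_eq_2[symmetric] algebra_simps)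

text \<open>The ratio \<open>y / x\<close> lies between 1/2 and 2; the sign of \<open>a\<close>
  decides which end is extremal. The absolute value covers both signs, as \<open>\<rho>\<close> may
  be negative.\<close>

lemma powr_le_powr_of_half_le:
  fixes x y a :: real
  assumes "x > 0" and "y \<in> {x / 2..2 * x}"
  shows "y powr a \<le> 2 powr \<bar>a\<bar> * x powr a"
proof -
  have y: "y / x \<in> {1 / 2..2}" using assms by (auto simp: field_simps)
  have "(y / x) powr a \<le> 2 powr \<bar>a\<bar>"
  proof (cases "a \<ge> 0")
    case True
    have "0 \<le> y / x" using assms by auto
    thus ?thesis using True y powr_mono2[of a "y / x" 2] by simp
  next
    case False
    hence "(y / x) powr a \<le> (1 / 2) powr a"
      using y by (intro powr_mono2') auto
    also have "\<dots> = 2 powr \<bar>a\<bar>"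
      using False by (simp add: powr_divide powr_minus_divide)
    finally show ?thesis .
  qed
  hence "(y / x) powr a * x powr a \<le> 2 powr \<bar>a\<bar> * x powr a"
    by (intro mult_right_mono) auto
  thus ?thesis
    using assms by (simp add: powr_divide)
qed

text \<open>The mean value inequality on \<open>{x / 2..2 * x}\<close>, where the derivative is
  comparable to its value at \<open>x\<close>.\<close>

lemma abs_powr_diff_le:
  fixes x y a :: real
  assumes x: "x > 0" and y: "y \<in> {x / 2..2 * x}" and "\<bar>y - x\<bar> \<le> 1"
  shows "\<bar>y powr a - x powr a\<bar> \<le> \<bar>a\<bar> * 2 powr \<bar>a - 1\<bar> * x powr (a - 1)"
proof -
  have "norm (y powr a - x powr a) \<le> (\<bar>a\<bar> * (2 powr \<bar>a - 1\<bar> * x powr (a - 1))) * norm (y - x)"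
  proof (rule field_differentiable_bound[where S = "{x / 2..2 * x}"])
    fix z assume z: "z \<in> {x / 2..2 * x}"
    thus "((\<lambda>z. z powr a) has_field_derivative a * z powr (a - 1)) (at z within {x / 2..2 * x})"
      using x by (auto intro!: derivative_eq_intros)
    show "norm (a * z powr (a - 1)) \<le> \<bar>a\<bar> * (2 powr \<bar>a - 1\<bar> * x powr (a - 1))"
      using powr_le_powr_of_half_le[OF x z, of "a - 1"]
      by (auto simp: abs_mult intro!: mult_left_mono)
  qed (use x y in auto)
  also have "\<dots> \<le> (\<bar>a\<bar> * (2 powr \<bar>a - 1\<bar> * x powr (a - 1))) * 1"
    using assms by (intro mult_left_mono) auto
  finally show ?thesis by (simp add: mult.assoc)
qed

text \<open>The interpolation weights sum to 1, so the error at \<open>x\<close> combines the errors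
  at the two neighbouring integers. Replacing \<open>n powr \<rho>\<close> by
  \<open>x powr \<rho>\<close> costs order \<open>x powr (\<rho> - 1)\<close>, which is why
  \<open>\<delta> \<le> 1\<close> is assumed.\<close>

lemma interpolate_powr_approx:
  assumes cont: "continuous_on {0..1} \<phi>" and \<phi>: "\<phi> 0 = 0" "\<phi> 1 = 1"
    and g: "\<And>n. n \<ge> 1 \<Longrightarrow> \<bar>g n - real n powr \<rho>\<bar> \<le> C * real n powr (\<rho> - \<delta>)"
    and C: "C \<ge> 0" and \<delta>: "\<delta> \<le> 1"
  obtains K where "K \<ge> 0"
    and "\<And>x. x \<ge> 1 \<Longrightarrow> \<bar>interpolate \<phi> g x - x powr \<rho>\<bar> \<le> K * x powr (\<rho> - \<delta>)"
proof -
  have "bounded (\<phi> ` {0..1})"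
    by (intro compact_imp_bounded compact_continuous_image cont) auto
  then obtain B where B: "B > 0" "\<And>t. t \<in> {0..1} \<Longrightarrow> \<bar>\<phi> t\<bar> \<le> B"
    by (auto simp: bounded_pos)
  \<comment> \<open>The first summand transfers the error of \<open>g n\<close> from
    \<open>n\<close> to \<open>x\<close>; the second bounds the change of the main term between
    \<open>n\<close> and \<open>x\<close>.\<close>
  define L where "L = C * 2 powr \<bar>\<rho> - \<delta>\<bar> + \<bar>\<rho>\<bar> * 2 powr \<bar>\<rho> - 1\<bar>"
  have L: "L \<ge> 0" using C by (simp add: L_def)
  have step: "\<bar>g n - x powr \<rho>\<bar> \<le> L * x powr (\<rho> - \<delta>)"
    if "x \<ge> 1" "n \<ge> 1" "real n \<in> {x / 2..2 * x}" "\<bar>real n - x\<bar> \<le> 1" for n x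
  proof -
    have "\<bar>g n - real n powr \<rho>\<bar> \<le> C * real n powr (\<rho> - \<delta>)"
      by (rule g) fact
    also have "\<dots> \<le> C * (2 powr \<bar>\<rho> - \<delta>\<bar> * x powr (\<rho> - \<delta>))"
      by (intro mult_left_mono powr_le_powr_of_half_le) (use that C in auto)
    finally have 1: "\<bar>g n - real n powr \<rho>\<bar> \<le> C * 2 powr \<bar>\<rho> - \<delta>\<bar> * x powr (\<rho> - \<delta>)"
      by (simp add: mult.assoc)
    have "\<bar>real n powr \<rho> - x powr \<rho>\<bar> \<le> \<bar>\<rho>\<bar> * 2 powr \<bar>\<rho> - 1\<bar> * x powr (\<rho> - 1)"
      by (rule abs_powr_diff_le) (use that in auto)
    also have "\<dots> \<le> \<bar>\<rho>\<bar> * 2 powr \<bar>\<rho> - 1\<bar> * x powr (\<rho> - \<delta>)"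
      using \<delta> that by (intro mult_left_mono powr_mono) auto
    finally show ?thesis
      using 1 unfolding L_def distrib_right by linarith
  qed
  show thesis
  \<comment> \<open>The weights \<open>1 - \<phi> t\<close> and \<open>\<phi> t\<close> are at most
    \<open>1 + B\<close> and \<open>B\<close> in absolute value.\<close>
  proof (rule that[of "(1 + 2 * B) * L"])
    show "(1 + 2 * B) * L \<ge> 0" using B L by simp
    fix x :: real assume x: "x \<ge> 1"
    obtain n t where n: "n \<ge> 1" and t: "t \<in> {0..<1}" and x_eq: "x = real n + t"
      using nat_floor_frac_cases[OF x] by auto
    have n_ge: "real n \<ge> 1" using n by simp
    have "interpolate \<phi> g x - x powr \<rho>
        = (1 - \<phi> t) * (g n - x powr \<rho>) + \<phi> t * (g (n + 1) - x powr \<rho>)"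
      unfolding x_eq using interpolate_add[OF \<phi> n, of t g] t by (simp add: algebra_simps)
    also have "\<bar>\<dots>\<bar> \<le> \<bar>1 - \<phi> t\<bar> * \<bar>g n - x powr \<rho>\<bar> + \<bar>\<phi> t\<bar> * \<bar>g (n + 1) - x powr \<rho>\<bar>"
      by (rule order_trans[OF abs_triangle_ineq]) (simp add: abs_mult)
    also have "\<dots> \<le> (1 + B) * (L * x powr (\<rho> - \<delta>)) + B * (L * x powr (\<rho> - \<delta>))"
      using B(2)[of t] B(1) t n_ge L n x
      by (intro add_mono mult_mono step) (auto simp: x_eq field_simps)
    finally show "\<bar>interpolate \<phi> g x - x powr \<rho>\<bar> \<le> (1 + 2 * B) * L * x powr (\<rho> - \<delta>)"
      by (simp add: algebra_simps)
  qed
qed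

section \<open>Asymptotic expansion\<close>

theorem theoremA2:
  fixes \<alpha> \<beta> \<rho> \<epsilon> :: real
    and f g g\<^sub>0 :: "nat \<Rightarrow> real"
    and \<phi> :: "real \<Rightarrow> real"
  assumes "\<alpha> > 0" and "\<beta> > 0"
    and "\<rho> = log 2 (\<alpha> + \<beta>)"
    and "\<And>n. n \<ge> 2 \<Longrightarrow>
           f n = \<alpha> * f (nat \<lfloor>real n / 2\<rfloor>) + \<beta> * f (nat \<lceil>real n / 2\<rceil>) + g n"
    and "g 1 = 0"
    and "interpolation_fun \<alpha> \<beta> \<phi>"
    and "\<And>n. n \<ge> 2 \<Longrightarrow> g n = real n powr \<rho> + g\<^sub>0 n"
    and "\<epsilon> > 0"
    and "g\<^sub>0 \<in> O(\<lambda>n. real n powr (\<rho> - \<epsilon>))"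
  shows "\<exists>(P :: real \<Rightarrow> real) (Q :: nat \<Rightarrow> real) (G :: complex \<Rightarrow> complex).
      continuous_on UNIV P \<and> (\<forall>t. P (t + 1) = P t) \<and>
      Q \<in> o(\<lambda>n. real n powr \<rho>) \<and>
      (\<forall>n\<ge>1. f n = real n powr \<rho> * log 2 (real n) + real n powr \<rho> * P (log 2 (real n)) - Q n) \<and>
      (\<forall>s. Re s < - \<rho> \<longrightarrow>
         mellin_integrand (interpolate \<phi> g) s absolutely_integrable_on {1..} \<and>
         G s = mellin (interpolate \<phi> g) s) \<and>
      G meromorphic_on {s. Re s < - \<rho> + min \<epsilon> 1} \<and>
      G holomorphic_on {s. Re s < - \<rho> + min \<epsilon> 1} - {- of_real \<rho>} \<and>
      is_pole G (- of_real \<rho>) \<and> zorder G (- of_real \<rho>) = - 1 \<and>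
      (\<forall>k. fourier_coeff P k =
         of_real (f 1) / of_real (ln 2) *
           integral {0..1} (\<lambda>u. of_real (1 + (\<alpha> + \<beta> - 1) * \<phi> u) /
                                of_real (1 + u) powr (of_real \<rho> + chi k + 1)) +
         (if k \<noteq> 0 then 1 / of_real (ln 2) * G (- of_real \<rho> - chi k)
          else 1 / of_real (ln 2) * finite_value G (- of_real \<rho>) + 1 / 2)) \<and>
      ((\<forall>n\<ge>2. even n \<longrightarrow> g n = real n powr \<rho>) \<longrightarrow> (\<forall>n\<ge>1. Q n = 0))"
proof -
  define \<delta> where "\<delta> = min \<epsilon> 1"
  have \<delta>: "\<delta> > 0" "\<delta> \<le> \<epsilon>" "\<delta> \<le> 1"
    using assms(8) by (auto simp: \<delta>_def)
  have cont_\<phi>: "continuous_on {0..1} \<phi>" and \<phi>01: "\<phi> 0 = 0" "\<phi> 1 = 1"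
    using assms(6) by (auto simp: interpolation_fun_def)
  have pow_\<rho>: "2 powr \<rho> = \<alpha> + \<beta>"
    using assms(1-3) by simp
  have f2: "f 2 = (\<alpha> + \<beta>) * f 1 + g 2"
    using assms(4)[of 2] by (simp add: algebra_simps)

  \<comment> \<open>Uniform bounds for \<open>g\<close> and its interpolation\<close>
  obtain C where C: "C \<ge> 0" "\<And>n. n \<ge> 1 \<Longrightarrow> \<bar>g n - real n powr \<rho>\<bar> \<le> C * real n powr (\<rho> - \<delta>)"
  proof -
    obtain c where c: "c > 0" "\<forall>\<^sub>F n in sequentially. norm (g\<^sub>0 n) \<le> c * norm (real n powr (\<rho> - \<epsilon>))"
      using landau_o.bigE[OF assms(9)] by blast
    then obtain N where N: "\<And>n. n \<ge> N \<Longrightarrow> \<bar>g\<^sub>0 n\<bar> \<le> c * real n powr (\<rho> - \<epsilon>)"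
      by (auto simp: eventually_sequentially)
    define r where "r = (\<lambda>n. \<bar>g n - real n powr \<rho>\<bar> / real n powr (\<rho> - \<delta>))"
    have r: "r n \<ge> 0" for n by (simp add: r_def)
    \<comment> \<open>The sum absorbs the finitely many initial indices, among them
      \<open>n = 1\<close>, where \<open>g\<close> is 0. Cutting at \<open>N + 2\<close> ensures
      \<open>n \<ge> 2\<close> in the other case, where the decomposition with
      \<open>g\<^sub>0\<close> is available.\<close>
    define C where "C = c + (\<Sum>n<N + 2. r n)"
    have sum_nonneg: "(\<Sum>n<N + 2. r n) \<ge> 0" by (intro sum_nonneg r)
    have "r n \<le> C" if "n \<ge> 1" for n
    proof (cases "n < N + 2")
      case True
      hence "r n \<le> (\<Sum>n<N + 2. r n)"
        by (intro member_le_sum) (auto simp: r)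
      thus ?thesis using c by (simp add: C_def)
    next
      case False
      have "\<bar>g n - real n powr \<rho>\<bar> \<le> c * real n powr (\<rho> - \<epsilon>)"
        using N[of n] assms(7)[of n] False by simp
      also have "\<dots> \<le> c * real n powr (\<rho> - \<delta>)"
        using \<delta> c that by (intro mult_left_mono powr_mono) auto
      finally have "r n \<le> c"
        using that by (simp add: r_def field_simps)
      thus ?thesis using sum_nonneg by (simp add: C_def)
    qed
    hence "\<bar>g n - real n powr \<rho>\<bar> \<le> C * real n powr (\<rho> - \<delta>)" if "n \<ge> 1" for n
      using that by (simp add: r_def field_simps)
    moreover have "C \<ge> 0" using sum_nonneg c by (simp add: C_def)
    ultimately show thesis using that by blast
  qed
  obtain K where K: "K \<ge> 0"
    "\<And>x. x \<ge> 1 \<Longrightarrow> \<bar>interpolate \<phi> g x - x powr \<rho>\<bar> \<le> K * x powr (\<rho> - \<delta>)"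
    using interpolate_powr_approx[OF cont_\<phi> \<phi>01 C(2,1) \<delta>(3)] by blast

  \<comment> \<open>The relative deviation \<open>D\<close> and the periodic function\<close>
  define D where "D = (\<lambda>x. interpolate \<phi> g x * x powr -\<rho> - 1)"
  have cont_D: "continuous_on {1..} D"
    unfolding D_def by (intro continuous_intros continuous_on_interpolate cont_\<phi> \<phi>01) auto
  have D_eq: "interpolate \<phi> g x = x powr \<rho> * (1 + D x)" if "x \<ge> 1" for x
    using that by (simp add: D_def powr_minus field_simps)
  have D_bound: "\<bar>D x\<bar> \<le> K * x powr -\<delta>" if "x \<ge> 1" for x
  proof -
    have "D x = x powr -\<rho> * (interpolate \<phi> g x - x powr \<rho>)"
      using that by (simp add: D_def algebra_simps flip: powr_add)
    hence "\<bar>D x\<bar> = x powr -\<rho> * \<bar>interpolate \<phi> g x - x powr \<rho>\<bar>"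
      by (simp add: abs_mult)
    also have "\<dots> \<le> x powr -\<rho> * (K * x powr (\<rho> - \<delta>))"
      by (intro mult_left_mono K that) auto
    also have "\<dots> = K * x powr -\<delta>"
      by (simp add: algebra_simps flip: powr_add)
    finally show ?thesis .
  qed
  have D_1: "D 1 = -1"
    using interpolate_of_nat[of \<phi> 1 g] \<phi>01 assms(5) by (simp add: D_def)
  have summable_D: "summable (\<lambda>j. D (2 ^ j * x))" if "x \<ge> 1" for x
    by (rule summable_dyadic[OF D_bound \<delta>(1) that])

  \<comment> \<open>The doubled argument makes this the dyadic series without its term
    \<open>j = 0\<close>.\<close>
  define T where "T = (\<lambda>x. \<Sum>j. D (2 ^ j * (2 * x)))"
  have T_head: "(\<Sum>j. D (2 ^ j * x)) = D x + T x" if "x \<ge> 1" for x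
    using suminf_split_head[OF summable_D[OF that]] by (simp add: T_def mult_ac)
  define S where "S = (\<lambda>t. \<Sum>j. D (2 powr (real j + t)))"
  have S_eq: "S t = D (2 powr t) + T (2 powr t)" if "t \<ge> 0" for t
    using T_head[of "2 powr t"] that
    by (simp add: S_def powr_add powr_realpow ge_one_powr_ge_zero)
  \<comment> \<open>The normalised contribution of the initial value \<open>f 1\<close> on the base
    interval.\<close>
  define w where "w = (\<lambda>x. (1 + (\<alpha> + \<beta> - 1) * \<phi> (x - 1)) * x powr -\<rho>)"
  have cont_w: "continuous_on {1..2} w"
  proof -
    have "continuous_on {1..2} (\<lambda>x. \<phi> (x - 1))"
      by (rule continuous_on_compose2[OF cont_\<phi>]) (auto intro!: continuous_intros)
    thus ?thesis unfolding w_def by (intro continuous_intros) auto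
  qed
  define p where "p = (\<lambda>t. 1 - t + S t + f 1 * w (2 powr t))"
  have cont_p: "continuous_on {0..1} p"
  proof -
    have "2 powr t \<le> (2 :: real)" if "t \<le> 1" for t
      using powr_mono[of t 1 2] that by simp
    hence "continuous_on {0..1} (\<lambda>t. w (2 powr t))"
      by (intro continuous_on_compose2[OF cont_w])
         (auto intro!: continuous_intros simp: ge_one_powr_ge_zero)
    moreover have "continuous_on {0..1} S"
      unfolding S_def by (rule continuous_on_dyadic_sum[OF cont_D D_bound K(1) \<delta>(1)])
    ultimately show ?thesis unfolding p_def by (intro continuous_intros)
  qed
  \<comment> \<open>From \<open>t = 0\<close> to \<open>t = 1\<close> the term \<open>1 - t\<close>
    loses 1, while \<open>S\<close> loses its head \<open>D 1 = -1\<close>; these cancel. The ends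
    of \<open>w\<close> agree because \<open>2 powr \<rho> = \<alpha> + \<beta>\<close>.\<close>
  have p01: "p 0 = p 1"
  proof -
    have "w 1 = 1" by (simp add: w_def \<phi>01)
    moreover have "w 2 = 1"
      using pow_\<rho> assms(1,2) by (simp add: w_def \<phi>01 powr_minus)
    moreover have "S 0 = - 1 + T 1"
      using S_eq[of 0] D_1 by simp
    moreover have "S 1 = T 1"
      by (simp add: S_def T_def powr_add powr_realpow)
    ultimately show ?thesis by (simp add: p_def)
  qed
  define P where "P = (\<lambda>t. p (frac t))"
  define Q where "Q = (\<lambda>n. real n powr \<rho> * T (real n))"
  define M where "M = (\<lambda>s. mellin D (s + of_real \<rho>))"
  \<comment> \<open>The denominator keeps the shape used in \<open>simple_pole_extension\<close>, so
    that its conclusions can be folded to \<open>G\<close>.\<close>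
  define G where "G = (\<lambda>s. M s - 1 / (s - (- of_real \<rho>)))"

  have cont_P: "continuous_on UNIV P"
    unfolding P_def by (rule continuous_on_frac_compose[OF cont_p p01])
  have per_P: "P (t + 1) = P t" for t
    by (simp add: P_def frac_def)

  \<comment> \<open>Exact representation at real arguments\<close>
  have rep: "interpolate \<phi> f x = x powr \<rho> * (log 2 x + P (log 2 x) - T x)" if "x \<ge> 1" for x
  proof -
    \<comment> \<open>Induction over growing dyadic ranges: the range \<open>{1..<2}\<close> is the
      base, and halving \<open>x\<close> reduces each range to the previous one.\<close>
    have "\<forall>x. 1 \<le> x \<and> x < 2 ^ Suc n \<longrightarrow>
        interpolate \<phi> f x = x powr \<rho> * (log 2 x + P (log 2 x) - T x)" for n :: nat
    proof (induction n)
      case 0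
      show ?case
      proof (intro allI impI)
        fix x :: real assume "1 \<le> x \<and> x < 2 ^ Suc 0"
        hence x: "1 \<le> x" "x < 2" by auto
        have l: "0 \<le> log 2 x" "log 2 x < 1" using x by auto
        have "P (log 2 x) = p (log 2 x)"
          using l by (simp add: P_def frac_eq)
        also have "\<dots> = 1 - log 2 x + (D x + T x) + f 1 * w x"
          using S_eq[OF l(1)] x by (simp add: p_def)
        finally have "x powr \<rho> * (log 2 x + P (log 2 x) - T x) = x powr \<rho> * (1 + D x) + f 1 * (x powr \<rho> * w x)"
          by (simp add: algebra_simps)
        also have "x powr \<rho> * w x = 1 + (\<alpha> + \<beta> - 1) * \<phi> (x - 1)"
          using x by (simp add: w_def powr_minus)
        finally show "interpolate \<phi> f x = x powr \<rho> * (log 2 x + P (log 2 x) - T x)"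
          using interpolate_initial[of \<phi> f \<alpha> \<beta> g x, OF \<phi>01 f2 assms(5)] x D_eq[of x] by simp
      qed
    next
      case (Suc n)
      show ?case
      proof (intro allI impI)
        fix x :: real assume x: "1 \<le> x \<and> x < 2 ^ Suc (Suc n)"
        show "interpolate \<phi> f x = x powr \<rho> * (log 2 x + P (log 2 x) - T x)"
        proof (cases "x < 2")
          case True
          hence "x < 2 ^ Suc n"
            using one_le_power[of "2 :: real" n] by (simp only: power_Suc) linarith
          thus ?thesis using Suc x by blast
        next
          case False
          hence half: "1 \<le> x / 2" "x / 2 < 2 ^ Suc n" using x by auto
          have log_half: "log 2 x = log 2 (x / 2) + 1"
            using x by (simp add: log_divide)
          \<comment> \<open>Halving shifts the series by one index and releases \<open>D x\<close>.
            Together with the 1 from \<open>log_half\<close> this is the factor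
            \<open>1 + D x\<close> of the interpolated \<open>g\<close>.\<close>
          have T_half: "T (x / 2) = D x + T x"
            using T_head[of x] x by (simp add: T_def)
          have "x powr \<rho> = (\<alpha> + \<beta>) * (x / 2) powr \<rho>"
            using x assms(1,2) by (simp add: powr_divide pow_\<rho>)
          hence "(\<alpha> + \<beta>) * interpolate \<phi> f (x / 2)
              = x powr \<rho> * (log 2 (x / 2) + P (log 2 (x / 2)) - T (x / 2))"
            using Suc half by simp
          moreover have "P (log 2 x) = P (log 2 (x / 2))"
            unfolding log_half by (rule per_P)
          ultimately show ?thesis
            using interpolate_recurrence[of \<alpha> \<beta> \<phi> f g x, OF assms(1,2,6,4)] False D_eq[of x]
            by (simp add: log_half T_half algebra_simps)
        qed
      qed
    qed
    moreover obtain n :: nat where "x < 2 ^ n"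
      using real_arch_pow[of 2 x] by auto
    hence "x < 2 ^ Suc n" using that by simp
    ultimately show ?thesis using that by blast
  qed

  have f_eq: "f n = real n powr \<rho> * log 2 (real n) + real n powr \<rho> * P (log 2 (real n)) - Q n"
    if "n \<ge> 1" for n
    using rep[of "real n"] interpolate_of_nat[of \<phi> n f] \<phi>01 that by (simp add: Q_def algebra_simps)

  \<comment> \<open>Size and vanishing of \<open>Q\<close>\<close>
  have Q_small: "Q \<in> o(\<lambda>n. real n powr \<rho>)"
  proof -
    \<comment> \<open>The geometric majorant of the series once the decay in \<open>x\<close> has
      been factored out.\<close>
    define c where "c = (\<Sum>j. K * (2 powr -\<delta>) ^ j)"
    have T_bound: "\<bar>T x\<bar> \<le> c * (2 * x) powr -\<delta>" if "x \<ge> 1" for x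
    proof -
      have "norm (T x) \<le> (\<Sum>j. (2 * x) powr -\<delta> * (K * (2 powr -\<delta>) ^ j))"
        unfolding T_def
      proof (rule norm_suminf_le)
        show "norm (D (2 ^ j * (2 * x))) \<le> (2 * x) powr -\<delta> * (K * (2 powr -\<delta>) ^ j)" for j
          using dyadic_term_le[OF D_bound, of "2 * x" j] that by (simp add: mult_ac)
      qed (intro summable_mult[OF summable_dyadic_geometric] \<delta>)
      also have "\<dots> = c * (2 * x) powr -\<delta>"
        unfolding c_def by (subst suminf_mult[OF summable_dyadic_geometric[OF \<delta>(1)]]) simp
      finally show ?thesis by simp
    qed
    have "(\<lambda>n. c * (2 * real n) powr -\<delta>) \<longlonglongrightarrow> c * 0"
      using \<delta>
      by (intro tendsto_intros tendsto_neg_powr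
          filterlim_tendsto_pos_mult_at_top[OF tendsto_const] filterlim_real_sequentially) auto
    hence "(\<lambda>n. c * (2 * real n) powr -\<delta>) \<longlonglongrightarrow> 0" by simp
    hence "(\<lambda>n. T (real n)) \<longlonglongrightarrow> 0"
      by (rule Lim_null_comparison[rotated])
         (use T_bound in \<open>auto intro!: eventually_sequentiallyI[of 1]\<close>)
    moreover have "\<forall>\<^sub>F n in sequentially. T (real n) = Q n / real n powr \<rho>"
      by (rule eventually_sequentiallyI[of 1]) (simp add: Q_def)
    ultimately have "(\<lambda>n. Q n / real n powr \<rho>) \<longlonglongrightarrow> 0"
      by (rule Lim_transform_eventually)
    thus ?thesis
      by (rule smalloI_tendsto) (auto intro!: eventually_sequentiallyI[of 1])
  qed

  have Q_zero: "Q n = 0" if even: "\<forall>n\<ge>2. even n \<longrightarrow> g n = real n powr \<rho>" and n: "n \<ge> 1" for n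
  proof -
    have "D (2 ^ j * (2 * real n)) = 0" for j
    proof -
      \<comment> \<open>The tail series samples \<open>D\<close> at integer arguments only at these
        even integers, where the interpolation returns \<open>g m\<close> itself.\<close>
      define m where "m = 2 ^ Suc j * n"
      have "n \<le> 2 ^ j * n" by simp
      hence m: "m \<ge> 2" "even m" using n by (auto simp: m_def)
      have "D (real m) = 0"
        using interpolate_of_nat[of \<phi> m g] \<phi>01 even m by (simp add: D_def flip: powr_add)
      thus ?thesis by (simp add: m_def mult_ac)
    qed
    thus ?thesis by (simp add: Q_def T_def)
  qed

  \<comment> \<open>Mellin transform and its continuation\<close>
  have mellin_G: "mellin_integrand (interpolate \<phi> g) s absolutely_integrable_on {1..} \<and>
      G s = mellin (interpolate \<phi> g) s" if s: "Re s < -\<rho>" for s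
  proof -
    \<comment> \<open>Writing the interpolated \<open>g\<close> as
      \<open>x powr \<rho> * (1 + D x)\<close> shifts the Mellin variable by \<open>\<rho>\<close>;
      the constant 1 produces the pole and \<open>D\<close> the holomorphic part.\<close>
    have split: "mellin_integrand D (s + of_real \<rho>) x + mellin_integrand (\<lambda>_. 1) (s + of_real \<rho>) x
        = mellin_integrand (interpolate \<phi> g) s x" if "x \<in> {1..}" for x
    proof -
      have "complex_of_real x powr (s + of_real \<rho> - 1) = of_real x powr (of_real \<rho> + (s - 1))"
        by (simp add: algebra_simps)
      also have "\<dots> = of_real (x powr \<rho>) * of_real x powr (s - 1)"
        using that by (subst powr_add) (simp add: powr_of_real)
      finally show ?thesis
        using D_eq[of x] that by (simp add: mellin_integrand_def algebra_simps)
    qed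
    have int_D: "mellin_integrand D (s + of_real \<rho>) absolutely_integrable_on {1..}"
      by (rule mellin_absolutely_integrable[OF cont_D D_bound K(1)]) (use s \<delta> in auto)
    have int_1: "mellin_integrand (\<lambda>_. 1) (s + of_real \<rho>) absolutely_integrable_on {1..}"
      by (rule mellin_absolutely_integrable[where C = 1 and \<delta> = 0]) (use s in auto)
    have "(\<lambda>x. mellin_integrand D (s + of_real \<rho>) x + mellin_integrand (\<lambda>_. 1) (s + of_real \<rho>) x)
        absolutely_integrable_on {1..}"
      by (rule set_integral_add(1)[OF int_D int_1])
    also have "?this \<longleftrightarrow> mellin_integrand (interpolate \<phi> g) s absolutely_integrable_on {1..}"
      by (intro set_integrable_cong refl split)
    finally have "mellin_integrand (interpolate \<phi> g) s absolutely_integrable_on {1..}" .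
    moreover have "mellin (interpolate \<phi> g) s
        = integral {1..} (\<lambda>x. mellin_integrand D (s + of_real \<rho>) x +
            mellin_integrand (\<lambda>_. 1) (s + of_real \<rho>) x)"
      unfolding mellin_def using split by (intro integral_cong) auto
    hence "mellin (interpolate \<phi> g) s
        = mellin D (s + of_real \<rho>) + mellin (\<lambda>_. 1) (s + of_real \<rho>)"
      unfolding mellin_def
      using int_D int_1 by (simp add: integral_add set_lebesgue_integral_eq_integral(1))
    hence "G s = mellin (interpolate \<phi> g) s"
      using mellin_one[of "s + of_real \<rho>"] s by (simp add: G_def M_def)
    ultimately show ?thesis by blast
  qed

  have "mellin D holomorphic_on {s. Re s < \<delta>}"
    by (rule holomorphic_mellin[OF cont_D D_bound K(1)])
  hence "(mellin D \<circ> (\<lambda>s. s + of_real \<rho>)) holomorphic_on {s. Re s < - \<rho> + \<delta>}"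
    by (intro holomorphic_on_compose_gen[where t = "{s. Re s < \<delta>}"] holomorphic_intros) auto
  hence hol_M: "M holomorphic_on {s. Re s < - \<rho> + \<delta>}"
    by (simp add: M_def o_def)
  have "- of_real \<rho> \<in> {s. Re s < - \<rho> + \<delta>}"
    using \<delta> by simp
  note pole = simple_pole_extension[OF hol_M open_halfspace_Re_lt this, folded G_def]

  \<comment> \<open>Fourier coefficients of \<open>P\<close>\<close>
  have fourier: "fourier_coeff P k =
      of_real (f 1) / of_real (ln 2) *
        integral {0..1} (\<lambda>u. of_real (1 + (\<alpha> + \<beta> - 1) * \<phi> u) /
                             of_real (1 + u) powr (of_real \<rho> + chi k + 1)) +
      (if k \<noteq> 0 then 1 / of_real (ln 2) * G (- of_real \<rho> - chi k)
       else 1 / of_real (ln 2) * finite_value G (- of_real \<rho>) + 1 / 2)" for k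
  proof -
    define E where "E = (\<lambda>t. exp (- 2 * of_int k * of_real pi * \<i> * complex_of_real t))"
    define I where "I = integral {0..1} (\<lambda>u. of_real (1 + (\<alpha> + \<beta> - 1) * \<phi> u) /
        of_real (1 + u) powr (of_real \<rho> + chi k + 1))"
    define J where "J = (if k = 0 then 1 / 2 else 1 / (of_real (ln 2) * chi k))"
    have I_eq: "integral {1..2} (mellin_integrand w (- chi k)) = I"
    proof -
      have "integral {1..2} (mellin_integrand w (- chi k))
          = integral {0..1} (mellin_integrand w (- chi k) \<circ> (\<lambda>u. u + 1))"
        using integral_shift[of 0 1 1 "mellin_integrand w (- chi k)"]
          continuous_on_mellin_integrand[OF cont_w, of "- chi k"]
        by force
      also have "\<dots> = I"
        unfolding I_def
      proof (rule integral_cong)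
        fix u :: real assume u: "u \<in> {0..1}"
        define y where "y = 1 + u"
        have y: "y > 0" using u by (simp add: y_def)
        have "complex_of_real (y powr -\<rho>) * of_real y powr (- chi k - 1)
            = of_real y powr (- of_real \<rho>) * of_real y powr (- chi k - 1)"
          using y by (simp add: powr_of_real flip: of_real_minus)
        also have "\<dots> = of_real y powr (- of_real \<rho> + (- chi k - 1))"
          by (rule powr_add[symmetric])
        also have "- of_real \<rho> + (- chi k - 1) = - (of_real \<rho> + chi k + 1)"
          by simp
        also have "of_real y powr - (of_real \<rho> + chi k + 1)
            = 1 / of_real y powr (of_real \<rho> + chi k + 1)"
          by (subst powr_minus) (simp add: divide_inverse)
        finally show "(mellin_integrand w (- chi k) \<circ> (\<lambda>u. u + 1)) u
            = of_real (1 + (\<alpha> + \<beta> - 1) * \<phi> u) / of_real (1 + u) powr (of_real \<rho> + chi k + 1)"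
          unfolding y_def by (simp add: mellin_integrand_def w_def add.commute[of u 1] mult.assoc)
      qed
      finally show ?thesis .
    qed
    have "((\<lambda>t. of_real (1 - t) * E t) has_integral J) {0..1}"
      unfolding E_def J_def by (rule has_integral_sawtooth)
    moreover have "((\<lambda>t. of_real (S t) * E t) has_integral
        mellin D (- chi k) / of_real (ln 2)) {0..1}"
      unfolding E_def S_def by (rule has_integral_dyadic_sum[OF cont_D D_bound K(1) \<delta>(1)])
    \<comment> \<open>The substitution for the single block \<open>j = 0\<close>, which is the
      interval from 1 to 2 where \<open>w\<close> is continuous.\<close>
    moreover have "((\<lambda>t. of_real (w (2 powr t)) * E t) has_integral I / of_real (ln 2)) {0..1}"
      using has_integral_dyadic_substitution[of 0 w k] cont_w I_eq by (simp add: E_def)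
    hence "((\<lambda>t. of_real (f 1) * (of_real (w (2 powr t)) * E t)) has_integral
        of_real (f 1) * (I / of_real (ln 2))) {0..1}"
      by (rule has_integral_mult_right)
    ultimately have "((\<lambda>t. of_real (1 - t) * E t + of_real (S t) * E t +
        of_real (f 1) * (of_real (w (2 powr t)) * E t)) has_integral
        J + mellin D (- chi k) / of_real (ln 2) + of_real (f 1) * (I / of_real (ln 2))) {0..1}"
      by (intro has_integral_add)
    hence "((\<lambda>t. of_real (P t) * E t) has_integral
        J + mellin D (- chi k) / of_real (ln 2) + of_real (f 1) * (I / of_real (ln 2))) {0..1}"
    proof (rule has_integral_eq[rotated])
      fix t :: real assume t: "t \<in> {0..1}"
      \<comment> \<open>At \<open>t = 1\<close> the fractional part is 0, and \<open>p01\<close>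
        closes the gap.\<close>
      have P_t: "P t = p t"
        using t p01 by (cases "t = 1") (auto simp: P_def frac_eq)
      show "of_real (1 - t) * E t + of_real (S t) * E t +
          of_real (f 1) * (of_real (w (2 powr t)) * E t) = of_real (P t) * E t"
        unfolding P_t p_def by (simp add: algebra_simps)
    qed
    hence "fourier_coeff P k
        = J + mellin D (- chi k) / of_real (ln 2) + of_real (f 1) * (I / of_real (ln 2))"
      unfolding fourier_coeff_def E_def by (rule integral_unique)
    moreover have "J + mellin D (- chi k) / of_real (ln 2)
        = (if k \<noteq> 0 then 1 / of_real (ln 2) * G (- of_real \<rho> - chi k)
           else 1 / of_real (ln 2) * finite_value G (- of_real \<rho>) + 1 / 2)"
    proof (cases "k = 0")
      case True
      thus ?thesis
        using pole(5) by (simp add: J_def M_def chi_def)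
    next
      case False
      \<comment> \<open>At \<open>s = - \<rho> - chi k\<close> the polar term
        \<open>- 1 / (s + \<rho>)\<close> equals \<open>1 / chi k\<close>, so after division by
        \<open>ln 2\<close> it is exactly \<open>J\<close>.\<close>
      have "chi k \<noteq> 0" using False by (simp add: chi_def)
      thus ?thesis
        using False by (simp add: J_def G_def M_def field_simps)
    qed
    ultimately show ?thesis
      by (simp add: I_def)
  qed

  show ?thesis
    unfolding \<delta>_def[symmetric]
    by (rule exI[of _ P], rule exI[of _ Q], rule exI[of _ G], intro conjI)
       (use cont_P per_P Q_small f_eq mellin_G pole fourier Q_zero in blast)+
qed

end
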